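(* Let $a_1,\dots,a_K\in\mathbb{B}^n$ with each $a_j\ne0$, and let $f=\frac{p}{q}=\phi_{a_1}\otimes\cdots\otimes\phi_{a_K}$ be the tensor product of the $K$ automorphisms $\phi_{a_j}$ of $\mathbb{B}^n$. Put $\rho=\|z\|^2-1$, $c_j=1-\|a_j\|^2$, and $\omega_j=\omega_j(z,\overline z)=|1-\langle z,a_j\rangle|^2$. Then $$\mathcal{H}(f)=\|p\|^2-|q|^2=\prod_{j=1}^K(c_j\rho+\omega_j)-\prod_{j=1}^K\omega_j.$$
   Context: $\mathbb{B}^n$ is the open unit ball of $\mathbb{C}^n$ and $\langle\cdot,\cdot\rangle$ the standard Hermitian inner product, linear in the first slot. For $a\in\mathbb{B}^n$ and $s=\sqrt{1-\|a\|^2}$, $$\phi_a(z)=\frac{a-L_a z}{1-\langle z,a\rangle},\qquad L_a(z)=\frac{\langle z,a\rangle a}{s+1}+sz,$$ which is a holomorphic automorphism of $\mathbb{B}^n$. The tensor product of maps is taken pointwise. A rational map is written $f=\frac pq$ in lowest terms with $q(0)=1$ ($p$ a vector-valued polynomial, $q$ a scalar polynomial), and its Hermitian form is the real-valued polynomial $\mathcal{H}(f)=\|p\|^2-|q|^2$. *)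

theory Defs
  imports "HOL-Analysis.Analysis"
begin

definition cinner :: "complex ^ 'n \<Rightarrow> complex ^ 'n \<Rightarrow> complex" where
  "cinner z w = (\<Sum>i\<in>UNIV. z $ i * cnj (w $ i))"

definition autL :: "complex ^ 'n \<Rightarrow> complex ^ 'n \<Rightarrow> complex ^ 'n" where
  "autL a z = (let s = complex_of_real (sqrt (1 - (norm a)\<^sup>2))
               in (cinner z a / (s + 1)) *s a + s *s z)"

definition ball_aut :: "complex ^ 'n \<Rightarrow> complex ^ 'n \<Rightarrow> complex ^ 'n" where
  "ball_aut a z = (1 / (1 - cinner z a)) *s (a - autL a z)"

(* The tensor product of K vectors in C^n lives in C^(n^K); its coordinates are indexed
   by the multi-indices \<sigma> assigning to each factor j a coordinate \<sigma> j.  Since complex ^ 'm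
   carries the Euclidean norm, norm is the Hermitian norm of the paper. *)
definition tensor_vec :: "('k::finite \<Rightarrow> complex ^ 'n) \<Rightarrow> complex ^ ('k \<Rightarrow> 'n)" where
  "tensor_vec v = (\<chi> \<sigma>. \<Prod>j\<in>UNIV. v j $ \<sigma> j)"

definition tensor_map ::
    "('k::finite \<Rightarrow> 'a \<Rightarrow> complex ^ 'n) \<Rightarrow> 'a \<Rightarrow> complex ^ ('k \<Rightarrow> 'n)" where
  "tensor_map g z = tensor_vec (\<lambda>j. g j z)"

(* Holomorphic polynomials in n variables, as functions on C^n: the field is infinite, so
   polynomial functions form the polynomial ring. *)
inductive complex_polynomial :: "(complex ^ 'n \<Rightarrow> complex) \<Rightarrow> bool" where
  const: "complex_polynomial (\<lambda>z. c)"
| coord: "complex_polynomial (\<lambda>z. z $ i)"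
| add: "complex_polynomial f \<Longrightarrow> complex_polynomial g \<Longrightarrow> complex_polynomial (\<lambda>z. f z + g z)"
| mult: "complex_polynomial f \<Longrightarrow> complex_polynomial g \<Longrightarrow> complex_polynomial (\<lambda>z. f z * g z)"

definition complex_polynomial_dvd ::
    "(complex ^ 'n \<Rightarrow> complex) \<Rightarrow> (complex ^ 'n \<Rightarrow> complex) \<Rightarrow> bool" where
  "complex_polynomial_dvd h g \<longleftrightarrow> (\<exists>k. complex_polynomial k \<and> (\<forall>z. g z = h z * k z))"

definition in_lowest_terms ::
    "(complex ^ 'n \<Rightarrow> complex ^ 'm) \<Rightarrow> (complex ^ 'n \<Rightarrow> complex) \<Rightarrow> bool" where
  "in_lowest_terms p q \<longleftrightarrow>
     (\<forall>h. complex_polynomial h \<and> complex_polynomial_dvd h q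
          \<and> (\<forall>i. complex_polynomial_dvd h (\<lambda>z. p z $ i))
        \<longrightarrow> h constant_on UNIV)"

(* f = p/q as rational maps on the unit ball, in lowest terms and with q(0) = 1.  The two
   sides are compared only where q does not vanish; nonvanishing of q on the ball is not
   part of the definition. *)
definition normalized_fraction_of ::
    "(complex ^ 'n \<Rightarrow> complex ^ 'm) \<Rightarrow> (complex ^ 'n \<Rightarrow> complex ^ 'm) \<Rightarrow>
     (complex ^ 'n \<Rightarrow> complex) \<Rightarrow> bool" where
  "normalized_fraction_of f p q \<longleftrightarrow>
     (\<forall>i. complex_polynomial (\<lambda>z. p z $ i)) \<and> complex_polynomial q \<and>
     in_lowest_terms p q \<and> q 0 = 1 \<and>
     (\<forall>z\<in>ball 0 1. q z \<noteq> 0 \<longrightarrow> f z = (1 / q z) *s p z)"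

definition hermitian_form ::
    "(complex ^ 'n \<Rightarrow> complex ^ 'm) \<Rightarrow> (complex ^ 'n \<Rightarrow> complex) \<Rightarrow> complex ^ 'n \<Rightarrow> real" where
  "hermitian_form p q z = (norm (p z))\<^sup>2 - (cmod (q z))\<^sup>2"

end

theory Submission
  imports Defs "HOL-Computational_Algebra.Polynomial"
begin

text \<open>
  Write \<open>v\<^sub>j(z) = a\<^sub>j - L z\<close> (with \<open>L\<close> belonging to \<open>a\<^sub>j\<close>) and
  \<open>l\<^sub>j(z) = 1 - \<langle>z, a\<^sub>j\<rangle>\<close>, so that \<open>v\<^sub>j / l\<^sub>j\<close> is the \<open>j\<close>-th automorphism, and let \<open>N\<close> be the
  tensor product of the \<open>v\<^sub>j\<close> and \<open>D\<close> the product of the \<open>l\<^sub>j\<close>. If \<open>p = N\<close> and \<open>q = D\<close>, the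
  formula follows from two facts about norms: the norm of a tensor product is the product of the norms
  (\<open>norm_tensor_vec\<close>), and \<open>\<parallel>v\<^sub>j\<parallel>\<^sup>2 = c\<^sub>j \<rho> + \<omega>\<^sub>j\<close> (\<open>norm_ball_aut_numerator\<close>).

  The substance is that \<open>N / D\<close> really is the normalized fraction in lowest terms. Both fractions
  represent the same map near the origin, hence \<open>p D = q N\<close> everywhere
  (\<open>normalized_fraction_cross_multiply\<close>). On the hyperplane \<open>l\<^sub>k = 0\<close> the left side vanishes, but
  \<open>N\<close> does not: by Cauchy-Schwarz such points satisfy \<open>\<parallel>z\<parallel> > 1\<close>, so \<open>\<rho> > 0\<close> and the norm
  formula makes every \<open>v\<^sub>j(z)\<close> nonzero. So \<open>q\<close> vanishes on the hyperplane and the linear polynomial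
  \<open>l\<^sub>k\<close> divides it (\<open>complex_polynomial_dvd_of_vanishing\<close>). Cancelling the factors \<open>l\<^sub>k\<close> one
  after another gives \<open>q = D r\<close> and \<open>p = r N\<close> for a polynomial \<open>r\<close>. This \<open>r\<close> is a common factor of
  \<open>q\<close> and all components of \<open>p\<close>, so it is constant, and \<open>q(0) = D(0) = 1\<close> makes it \<open>1\<close>.
\<close>

section \<open>Norms of the automorphism numerator and of tensors\<close>

lemma norm_vec_power2: "(norm (v :: complex ^ 'n))\<^sup>2 = (\<Sum>i\<in>UNIV. (cmod (v $ i))\<^sup>2)"
  by (simp add: norm_vec_def L2_set_def sum_nonneg)

lemma cinner_self: "cinner v v = complex_of_real ((norm v)\<^sup>2)"
  unfolding cinner_def norm_vec_power2 of_real_sum complex_norm_square ..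

lemma cnj_cinner: "cnj (cinner v w) = cinner w v"
  by (simp add: cinner_def mult.commute)

lemma cinner_add_left: "cinner (v + w) x = cinner v x + cinner w x"
  by (simp add: cinner_def algebra_simps sum.distrib)

lemma cinner_scale_left: "cinner (c *s v) x = c * cinner v x"
  by (simp add: cinner_def sum_distrib_left mult.assoc)

lemma cmod_cinner_le: "cmod (cinner v w) \<le> norm v * norm w"
proof -
  have "cmod (cinner v w) \<le> (\<Sum>i\<in>UNIV. \<bar>cmod (v $ i)\<bar> * \<bar>cmod (w $ i)\<bar>)"
    unfolding cinner_def by (rule order.trans[OF norm_sum]) (simp add: norm_mult)
  also have "\<dots> \<le> norm v * norm w"
    unfolding norm_vec_def by (rule L2_set_mult_ineq)
  finally show ?thesis .
qed

lemma cinner_lincomb_self: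
  "cinner (u *s v - t *s w) (u *s v - t *s w) =
    u * cnj u * cinner v v - u * cnj t * cinner v w - t * cnj u * cinner w v + t * cnj t * cinner w w"
  unfolding cinner_def
  by (simp add: sum_distrib_left algebra_simps sum.distrib sum_subtractf)

text \<open>
  With \<open>w = \<langle>z, a\<rangle>\<close> the vector in question is \<open>(1 - w / (s + 1)) a - s z\<close>. Expanding its Hermitian
  square, the relation \<open>\<parallel>a\<parallel>\<^sup>2 = (1 - s) (1 + s)\<close> cancels the denominators. The case
  \<open>\<parallel>z\<parallel> > 1\<close>, outside the domain of the automorphism, is the one that matters for common factors.
\<close>
lemma norm_ball_aut_numerator:
  assumes "a \<in> ball 0 1"
  shows "(norm (a - autL a z))\<^sup>2 =
    (1 - (norm a)\<^sup>2) * ((norm z)\<^sup>2 - 1) + (cmod (1 - cinner z a))\<^sup>2"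
proof -
  define s where "s = sqrt (1 - (norm a)\<^sup>2)"
  define S where "S = complex_of_real s"
  define w where "w = cinner z a"
  have "(norm a)\<^sup>2 < 1"
    using assms by (simp add: power_less_one_iff)
  then have s: "s \<ge> 0" "s\<^sup>2 = 1 - (norm a)\<^sup>2"
    by (auto simp: s_def)
  have S2: "complex_of_real ((norm a)\<^sup>2) = (1 - S) * (1 + S)"
  proof -
    have "(norm a)\<^sup>2 = (1 - s) * (1 + s)"
      using s(2) by (simp add: algebra_simps power2_eq_square)
    then show ?thesis by (simp add: S_def)
  qed
  have S1: "S + 1 \<noteq> 0"
    using s(1) by (simp add: S_def complex_eq_iff)
  have lin: "a - autL a z = (1 - w / (S + 1)) *s a - S *s z"
    by (simp add: autL_def w_def S_def s_def Let_def vec_eq_iff algebra_simps)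
  have aw: "cinner a z = cnj w"
    by (simp add: w_def cnj_cinner)
  have cS: "cnj S = S" by (simp add: S_def)
  \<comment> \<open>Expressing everything through the quotients turns the claim into a polynomial identity.\<close>
  define W where "W = w / (S + 1)"
  define W' where "W' = cnj w / (S + 1)"
  have WW: "w = W * (S + 1)" "cnj w = W' * (S + 1)" "cnj W = W'"
    using S1 by (simp_all add: W_def W'_def cS)
  have cW: "cnj (1 - W) = 1 - W'"
    by (simp add: WW(3))
  have "complex_of_real ((norm (a - autL a z))\<^sup>2) =
      (1 - W) * (1 - W') * ((1 - S) * (1 + S)) - (1 - W) * S * cnj w
      - S * (1 - W') * w + S * S * complex_of_real ((norm z)\<^sup>2)"
    unfolding cinner_self[symmetric] lin cinner_lincomb_self
    unfolding cinner_self S2 aw cS w_def[symmetric] W_def[symmetric] cW ..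
  also have "\<dots> = S * S * (complex_of_real ((norm z)\<^sup>2) - 1) + (1 - w) * (1 - cnj w)"
    unfolding WW(2) unfolding WW(1) by (simp add: algebra_simps)
  also have "\<dots> = complex_of_real (s\<^sup>2 * ((norm z)\<^sup>2 - 1) + (cmod (1 - w))\<^sup>2)"
    unfolding of_real_add complex_norm_square by (simp add: S_def power2_eq_square)
  finally show ?thesis
    unfolding of_real_eq_iff s(2) w_def .
qed

text \<open>Expanding a product of coordinate sums gives exactly one term per multi-index.\<close>
lemma norm_tensor_vec:
  fixes v :: "'k::finite \<Rightarrow> complex ^ 'n"
  shows "(norm (tensor_vec v))\<^sup>2 = (\<Prod>j\<in>UNIV. (norm (v j))\<^sup>2)"
proof -
  have "(norm (tensor_vec v))\<^sup>2 = (\<Sum>\<sigma>\<in>UNIV. \<Prod>j\<in>UNIV. (cmod (v j $ \<sigma> j))\<^sup>2)"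
    by (simp add: norm_vec_power2 tensor_vec_def prod_norm[symmetric] prod_power_distrib)
  also have "\<dots> = (\<Prod>j\<in>UNIV. \<Sum>i\<in>UNIV. (cmod (v j $ i))\<^sup>2)"
    using prod_sum_PiE[of UNIV "\<lambda>_. UNIV" "\<lambda>j i. (cmod (v j $ i))\<^sup>2"] by (simp add: PiE_UNIV_domain)
  finally show ?thesis
    by (simp add: norm_vec_power2)
qed

section \<open>Polynomial functions on complex coordinate space\<close>

lemma complex_polynomial_diff:
  assumes "complex_polynomial f" "complex_polynomial g"
  shows "complex_polynomial (\<lambda>z. f z - g z)"
  using complex_polynomial.add[OF assms(1) complex_polynomial.mult[OF complex_polynomial.const[of "-1"] assms(2)]]
  by simp

lemma complex_polynomial_sum:
  assumes "finite A" "\<And>i. i \<in> A \<Longrightarrow> complex_polynomial (f i)"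
  shows "complex_polynomial (\<lambda>z. \<Sum>i\<in>A. f i z)"
  using assms by (induction A) (auto intro: complex_polynomial.intros)

lemma complex_polynomial_prod:
  assumes "finite A" "\<And>i. i \<in> A \<Longrightarrow> complex_polynomial (f i)"
  shows "complex_polynomial (\<lambda>z. \<Prod>i\<in>A. f i z)"
  using assms by (induction A) (auto intro: complex_polynomial.intros)

lemma complex_polynomial_cinner: "complex_polynomial (\<lambda>z. cinner z a)"
  unfolding cinner_def
  by (intro complex_polynomial_sum complex_polynomial.intros) simp

lemma complex_polynomial_denominator: "complex_polynomial (\<lambda>z. 1 - cinner z a)"
  by (intro complex_polynomial_diff complex_polynomial_cinner complex_polynomial.const)

lemma complex_polynomial_numerator: "complex_polynomial (\<lambda>z. (a - autL a z) $ i)"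
proof -
  have "complex_polynomial (\<lambda>z. a $ i - (cinner z a * (a $ i / (complex_of_real (sqrt (1 - (norm a)\<^sup>2)) + 1))
      + complex_of_real (sqrt (1 - (norm a)\<^sup>2)) * z $ i))"
    by (intro complex_polynomial_diff complex_polynomial_cinner complex_polynomial.intros)
  then show ?thesis
    by (simp add: autL_def Let_def)
qed

text \<open>Restriction to a line through the origin reduces the identity theorem to one variable.\<close>
lemma complex_polynomial_on_line:
  assumes "complex_polynomial f"
  shows "\<exists>P. \<forall>t. poly P t = f (t *s z)"
  using assms
proof induction
  case (const c)
  show ?case by (rule exI[of _ "[:c:]"]) simp
next
  case (coord i)
  show ?case by (rule exI[of _ "[:0, z $ i:]"]) simp
next
  case (add f g)
  then show ?case by (metis poly_add)
next
  case (mult f g)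
  then show ?case by (metis poly_mult)
qed

text \<open>
  Identity theorem and absence of zero divisors in one: on the line through \<open>0\<close> and \<open>z\<close> the product
  of the two restrictions has infinitely many roots, so it is the zero polynomial, and the first factor
  is nonzero because of its value at the origin.
\<close>
lemma complex_polynomial_cancel:
  assumes f: "complex_polynomial f" and f0: "f 0 \<noteq> 0" and g: "complex_polynomial g"
    and fg: "\<And>x. x \<in> ball 0 1 \<Longrightarrow> f x * g x = 0"
  shows "g z = 0"
proof -
  obtain P Q where P: "\<And>t. poly P t = f (t *s z)" and Q: "\<And>t. poly Q t = g (t *s z)"
    using complex_polynomial_on_line[OF f] complex_polynomial_on_line[OF g] by metis
  define r where "r = 1 / (norm z + 1)"
  have r: "r > 0" by (simp add: r_def add_nonneg_pos)
  have "poly (P * Q) t = 0" if t: "t \<in> ball 0 r" for t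
  proof -
    have "norm (t *s z) = cmod t * norm z"
      by (simp add: norm_vec_def norm_mult L2_set_right_distrib)
    also have "\<dots> \<le> cmod t * (norm z + 1)"
      by (intro mult_left_mono) auto
    also have "\<dots> < 1"
      using t by (simp add: r_def pos_less_divide_eq add_nonneg_pos)
    finally show ?thesis
      using fg[of "t *s z"] by (simp add: P Q)
  qed
  then have "ball 0 r \<subseteq> {t. poly (P * Q) t = 0}" by blast
  moreover have "infinite (ball (0::complex) r)"
    using r using uncountable_ball[of r] countable_finite by metis
  ultimately have "P * Q = 0"
    using poly_roots_finite finite_subset by blast
  moreover have "P \<noteq> 0"
    using P[of 0] f0 by auto
  ultimately have "Q = 0" by simp
  then show ?thesis using Q[of 1] by simp
qed

text \<open>
  The affine projection along \<open>a\<close> onto the hyperplane \<open>\<langle>z, a\<rangle> = 1\<close> moves \<open>z\<close> by a multiple of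
  \<open>1 - \<langle>z, a\<rangle>\<close>. Hence every polynomial changes under it by a polynomial multiple of
  \<open>1 - \<langle>z, a\<rangle>\<close>; this passes to products by
  \<open>f g - f' g' = (f - f') g + f' (g - g')\<close>. If the polynomial vanishes on the hyperplane,
  its projected value is zero and only the multiple remains.
\<close>
lemma complex_polynomial_dvd_of_vanishing:
  fixes a :: "complex ^ 'n"
  assumes a: "a \<noteq> 0" and f: "complex_polynomial f"
    and van: "\<And>z. cinner z a = 1 \<Longrightarrow> f z = 0"
  shows "complex_polynomial_dvd (\<lambda>z. 1 - cinner z a) f"
proof -
  define b where "b = (1 / complex_of_real ((norm a)\<^sup>2)) *s a"
  define proj where "proj z = z + (1 - cinner z a) *s b" for z
  have on: "cinner (proj z) a = 1" for z
    using a by (simp add: proj_def b_def cinner_add_left cinner_scale_left cinner_self)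
  \<comment> \<open>The first conjunct keeps the quotient polynomial in the product case.\<close>
  have "complex_polynomial (\<lambda>z. f (proj z)) \<and>
    (\<exists>k. complex_polynomial k \<and> (\<forall>z. f z = (1 - cinner z a) * k z + f (proj z)))"
    using f
  proof induction
    case (const c)
    show ?case by (auto intro!: complex_polynomial.const exI[of _ "\<lambda>z. 0"])
  next
    case (coord i)
    have "complex_polynomial (\<lambda>z. z $ i + (1 - cinner z a) * b $ i)"
      by (intro complex_polynomial.intros complex_polynomial_denominator)
    moreover have "z $ i = (1 - cinner z a) * (- b $ i) + proj z $ i" for z
    proof -
      have "x = d * (- y) + (x + d * y)" for x d y :: complex
        by simp
      then show ?thesis
        unfolding proj_def vector_add_component vector_smult_component .
    qed
    ultimately show ?case
      using complex_polynomial.const[of "- b $ i"]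
      unfolding proj_def vector_add_component vector_smult_component by blast
  next
    case (add f g)
    then obtain k l where k: "complex_polynomial k" "\<And>z. f z = (1 - cinner z a) * k z + f (proj z)"
      and l: "complex_polynomial l" "\<And>z. g z = (1 - cinner z a) * l z + g (proj z)"
      by blast
    have "f z + g z = (1 - cinner z a) * (k z + l z) + (f (proj z) + g (proj z))" for z
      using k(2)[of z] l(2)[of z] by algebra
    moreover have "complex_polynomial (\<lambda>z. f (proj z) + g (proj z))"
      by (rule complex_polynomial.add[OF add.IH(1)[THEN conjunct1] add.IH(2)[THEN conjunct1]])
    ultimately show ?case
      by (intro conjI exI[of _ "\<lambda>z. k z + l z"] allI complex_polynomial.add[OF k(1) l(1)])
  next
    case (mult f g)
    then obtain k l where k: "complex_polynomial k" "\<And>z. f z = (1 - cinner z a) * k z + f (proj z)"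
      and l: "complex_polynomial l" "\<And>z. g z = (1 - cinner z a) * l z + g (proj z)"
      by blast
    have "f z * g z = (1 - cinner z a) * (k z * g z + f (proj z) * l z) + f (proj z) * g (proj z)" for z
    proof -
      have "f z * g z = (1 - cinner z a) * (k z * g z) + f (proj z) * g z"
        by (subst k(2)) (simp add: algebra_simps)
      also have "f (proj z) * g z = (1 - cinner z a) * (f (proj z) * l z) + f (proj z) * g (proj z)"
        by (subst l(2)) (simp add: algebra_simps)
      finally show ?thesis by (simp add: algebra_simps)
    qed
    moreover have "complex_polynomial (\<lambda>z. k z * g z + f (proj z) * l z)"
      by (intro complex_polynomial.add complex_polynomial.mult k(1) l(1) mult.hyps(2)
          mult.IH(1)[THEN conjunct1])
    moreover have "complex_polynomial (\<lambda>z. f (proj z) * g (proj z))"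
      by (rule complex_polynomial.mult[OF mult.IH(1)[THEN conjunct1] mult.IH(2)[THEN conjunct1]])
    ultimately show ?case
      by (intro conjI exI[of _ "\<lambda>z. k z * g z + f (proj z) * l z"] allI)
  qed
  then obtain k where k: "complex_polynomial k" "\<And>z. f z = (1 - cinner z a) * k z + f (proj z)"
    by blast
  have "f z = (1 - cinner z a) * k z" for z
    using k(2)[of z] unfolding van[OF on] by simp
  then show ?thesis
    unfolding complex_polynomial_dvd_def using k(1) by blast
qed

section \<open>The reduced fraction of a tensor product of automorphisms\<close>

text \<open>
  The pole set of one automorphism lies strictly outside the closed ball, where the norm formula makes
  the numerator of any automorphism nonzero. This is what excludes common factors between
  numerators and denominators belonging to different \<open>a\<close> and \<open>b\<close>.
\<close>
lemma ball_aut_numerator_nonzero: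
  assumes a: "a \<in> ball 0 1" and b: "b \<in> ball 0 1" and z: "cinner z b = 1"
  shows "a - autL a z \<noteq> 0"
proof -
  have "1 \<le> norm z * norm b"
    using cmod_cinner_le[of z b] z by simp
  moreover have "norm z * norm b \<le> norm z" "norm b < 1"
    using b by (auto intro: mult_left_le)
  ultimately have "norm z \<ge> 1" by linarith
  have "norm z \<noteq> 1" using \<open>1 \<le> norm z * norm b\<close> \<open>norm b < 1\<close> by auto
  then have "norm z > 1" using \<open>norm z \<ge> 1\<close> by simp
  then have "(norm z)\<^sup>2 - 1 > 0" by simp
  moreover have "1 - (norm a)\<^sup>2 > 0"
    using a by (simp add: power_less_one_iff)
  ultimately have "(norm (a - autL a z))\<^sup>2 > 0"
    unfolding norm_ball_aut_numerator[OF a] by (simp add: add_pos_nonneg)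
  then show ?thesis by auto
qed

lemma tensor_vec_nonzero:
  assumes "\<And>j. v j \<noteq> 0"
  shows "tensor_vec v \<noteq> 0"
proof -
  have "(norm (tensor_vec v))\<^sup>2 \<noteq> 0"
    unfolding norm_tensor_vec using assms by simp
  then show ?thesis by auto
qed

lemma tensor_map_ball_aut:
  "tensor_map (\<lambda>j. ball_aut (a j)) z =
    (1 / (\<Prod>j\<in>UNIV. 1 - cinner z (a j))) *s tensor_vec (\<lambda>j. a j - autL (a j) z)"
  by (simp add: tensor_map_def tensor_vec_def ball_aut_def vec_eq_iff prod_dividef
      flip: diff_divide_distrib)

text \<open>
  The two fractions are comparable only at points of the ball where neither denominator vanishes. The
  extra factor \<open>q D\<close> makes \<open>q D (p D - q N)\<close> vanish on the whole ball, and since \<open>q D\<close> is nonzero at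
  the origin it can be cancelled.
\<close>
lemma normalized_fraction_cross_multiply:
  assumes nf: "normalized_fraction_of f p q"
    and D: "complex_polynomial D" and N: "\<And>i. complex_polynomial (\<lambda>z. N z $ i)"
    and D0: "D 0 \<noteq> 0"
    and f: "\<And>z. z \<in> ball 0 1 \<Longrightarrow> D z \<noteq> 0 \<Longrightarrow> f z = (1 / D z) *s N z"
  shows "p z $ i * D z = q z * N z $ i"
proof -
  have p: "complex_polynomial (\<lambda>z. p z $ i)" and q: "complex_polynomial q" "q 0 = 1"
    and pq: "\<And>z. z \<in> ball 0 1 \<Longrightarrow> q z \<noteq> 0 \<Longrightarrow> f z = (1 / q z) *s p z"
    using nf by (auto simp: normalized_fraction_of_def)
  have "p z $ i * D z - q z * N z $ i = 0"
  proof (rule complex_polynomial_cancel[where f = "\<lambda>z. q z * D z"])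
    show "(q x * D x) * (p x $ i * D x - q x * N x $ i) = 0" if "x \<in> ball 0 1" for x
    proof (cases "q x * D x = 0")
      case False
      then have "(1 / q x) * p x $ i = (1 / D x) * N x $ i"
        using pq[OF that] f[OF that] by (metis mult_eq_0_iff vector_smult_component)
      then show ?thesis using False by (simp add: field_simps)
    qed simp
  qed (use p q D N D0 in \<open>auto intro!: complex_polynomial_diff complex_polynomial.mult\<close>)
  then show ?thesis by simp
qed

text \<open>
  The lowest-terms representation is identified by splitting the linear factors of the denominator off
  \<open>q\<close> one at a time.
\<close>
lemma normalized_fraction_tensor_ball_aut:
  fixes a :: "'k::finite \<Rightarrow> complex ^ 'n"
  assumes a: "\<And>j. a j \<in> ball 0 1" "\<And>j. a j \<noteq> 0"
    and nf: "normalized_fraction_of (tensor_map (\<lambda>j. ball_aut (a j))) p q"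
  shows "p z = tensor_vec (\<lambda>j. a j - autL (a j) z)" (is ?p)
    and "q z = (\<Prod>j\<in>UNIV. 1 - cinner z (a j))" (is ?q)
proof -
  define N where "N z = tensor_vec (\<lambda>j. a j - autL (a j) z)" for z
  define l where "l j z = 1 - cinner z (a j)" for j z
  have l: "complex_polynomial (l j)" for j
    using complex_polynomial_denominator[of "a j"] by (simp add: l_def[abs_def])
  have l0: "l j 0 = 1" for j
    by (simp add: l_def cinner_def)
  have lprod: "complex_polynomial (\<lambda>z. \<Prod>j\<in>A. l j z)" for A
    by (intro complex_polynomial_prod l) simp
  have N: "complex_polynomial (\<lambda>z. N z $ \<sigma>)" for \<sigma>
    unfolding N_def tensor_vec_def vec_lambda_beta
    by (intro complex_polynomial_prod complex_polynomial_numerator) simp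
  have p: "complex_polynomial (\<lambda>z. p z $ \<sigma>)" and q: "complex_polynomial q" "q 0 = 1" for \<sigma>
    using nf by (auto simp: normalized_fraction_of_def)
  have cross: "p z $ \<sigma> * (\<Prod>j\<in>UNIV. l j z) = q z * N z $ \<sigma>" for z \<sigma>
    by (rule normalized_fraction_cross_multiply[OF nf lprod N])
      (simp_all add: l0, simp add: tensor_map_ball_aut N_def l_def)
  \<comment> \<open>The factors indexed by \<open>A\<close> have been split off \<open>q\<close> and cancelled from both sides
    of \<open>p D = q N\<close>.\<close>
  have "\<exists>r. complex_polynomial r \<and> (\<forall>z. q z = (\<Prod>j\<in>A. l j z) * r z) \<and>
      (\<forall>z \<sigma>. p z $ \<sigma> * (\<Prod>j\<in>-A. l j z) = r z * N z $ \<sigma>)" for A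
  proof (induction A rule: finite_induct[OF finite])
    case 1
    show ?case using q cross by (auto intro!: exI[of _ q])
  next
    case (2 k A)
    then obtain r where r: "complex_polynomial r" "\<And>z. q z = (\<Prod>j\<in>A. l j z) * r z"
      "\<And>z \<sigma>. p z $ \<sigma> * (\<Prod>j\<in>-A. l j z) = r z * N z $ \<sigma>"
      by blast
    have peel: "(\<Prod>j\<in>-A. l j z) = l k z * (\<Prod>j\<in>-insert k A. l j z)" for z
    proof -
      have "- A = insert k (- insert k A)" using 2 by auto
      then show ?thesis by (metis prod.insert finite ComplD insertI1)
    qed
    have "r z = 0" if z: "cinner z (a k) = 1" for z
    proof -
      have "N z \<noteq> 0"
        unfolding N_def using ball_aut_numerator_nonzero[OF a(1) a(1) z] by (rule tensor_vec_nonzero)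
      then obtain \<sigma> where "N z $ \<sigma> \<noteq> 0" by (auto simp: vec_eq_iff)
      moreover have "r z * N z $ \<sigma> = 0"
        using r(3)[of z \<sigma>] z unfolding peel by (simp add: l_def)
      ultimately show ?thesis by simp
    qed
    from complex_polynomial_dvd_of_vanishing[OF a(2) r(1) this]
    obtain r' where r': "complex_polynomial r'" "\<And>z. r z = l k z * r' z"
      unfolding complex_polynomial_dvd_def l_def by blast
    have "p z $ \<sigma> * (\<Prod>j\<in>-insert k A. l j z) - r' z * N z $ \<sigma> = 0" for z \<sigma>
    proof (rule complex_polynomial_cancel[OF l[of k]])
      show "l k x * (p x $ \<sigma> * (\<Prod>j\<in>-insert k A. l j x) - r' x * N x $ \<sigma>) = 0" for x
        using r(3)[of x \<sigma>] by (simp add: r'(2) peel algebra_simps)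
    qed (auto simp: l0 intro!: complex_polynomial_diff complex_polynomial.mult p lprod r' N)
    then show ?case
      using r' r(2) 2 by (auto intro!: exI[of _ r'] simp: algebra_simps)
  qed
  from this[of UNIV] obtain r where r: "complex_polynomial r"
    "\<And>z. q z = (\<Prod>j\<in>UNIV. l j z) * r z" "\<And>z \<sigma>. p z $ \<sigma> = r z * N z $ \<sigma>"
    by auto
  have "complex_polynomial_dvd r q"
    unfolding complex_polynomial_dvd_def using lprod[of UNIV] r(2) by (auto simp: mult.commute)
  moreover have "complex_polynomial_dvd r (\<lambda>z. p z $ \<sigma>)" for \<sigma>
    unfolding complex_polynomial_dvd_def using N[of \<sigma>] r(3) by blast
  ultimately have "r constant_on UNIV"
    using nf r(1) by (auto simp: normalized_fraction_of_def in_lowest_terms_def)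
  moreover have "r 0 = 1"
    using r(2)[of 0] q(2) by (simp add: l0)
  ultimately have "r z = 1" for z
    by (auto simp: constant_on_def)
  then show ?p ?q
    using r(2,3) by (auto simp: vec_eq_iff N_def l_def)
qed

theorem proposition4p2:
  fixes a :: "'k::finite \<Rightarrow> complex ^ 'n"
    and p :: "complex ^ 'n \<Rightarrow> complex ^ ('k \<Rightarrow> 'n)"
    and q :: "complex ^ 'n \<Rightarrow> complex"
    and z :: "complex ^ 'n"
  assumes "\<And>j. a j \<in> ball 0 1"
    and "\<And>j. a j \<noteq> 0"
    and "normalized_fraction_of (tensor_map (\<lambda>j. ball_aut (a j))) p q"
  shows "hermitian_form p q z =
    (let \<rho> = (norm z)\<^sup>2 - 1;
         c = (\<lambda>j. 1 - (norm (a j))\<^sup>2);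
         \<omega> = (\<lambda>j. (cmod (1 - cinner z (a j)))\<^sup>2)
     in (\<Prod>j\<in>UNIV. c j * \<rho> + \<omega> j) - (\<Prod>j\<in>UNIV. \<omega> j))"
  using assms(1)
  by (simp add: hermitian_form_def normalized_fraction_tensor_ball_aut[OF assms] norm_tensor_vec
      norm_ball_aut_numerator Let_def prod_norm[symmetric] prod_power_distrib)

end
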